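(* For every integer $k\ge 3$, the graph $E(2.O_k)$ is not distance regular.
   Context: For $k\ge 3$, let $\Omega=\{1,\dots,2k-1\}$. The extended graph $E(2.O_k)$ is the simple graph with vertex set $\{(v,i) : v\subset\Omega,\ |v|=k-1,\ i\in\{0,1\}\}$ in which $(v,i)$ and $(w,j)$ are adjacent if and only if $i\ne j$ and either $v\cap w=\emptyset$ or $v=w$. For a vertex $x$ of a graph $\Gamma$, let $\Gamma_r(x)$ be the set of vertices at distance $r$ from $x$. A regular graph $\Gamma$ of diameter $d$ is distance regular if for each $r$ the numbers $c_r=|\Gamma_{r-1}(y)\cap\Gamma_1(x)|$ and $b_r=|\Gamma_{r+1}(y)\cap\Gamma_1(x)|$ are the same for all pairs of vertices $x,y$ at distance $r$. *)

theory Defs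
  imports "Graph_Theory.Pair_Digraph" "Graph_Theory.Shortest_Path"
begin

text \<open>
  A finite simple graph is a \<^locale>\<open>pair_graph\<close>: a finite, loopfree, symmetric digraph whose
  arcs are pairs of vertices.  The distance is the least number of arcs of a walk, that is,
  the minimal walk cost for unit weights; it is infinite if there is no walk.
\<close>

definition graph_dist :: "'a pair_pre_digraph \<Rightarrow> 'a \<Rightarrow> 'a \<Rightarrow> ereal" where
  "graph_dist G x y = wf_digraph.\<mu> (with_proj G) (\<lambda>_. 1) x y"

definition diameter :: "'a pair_pre_digraph \<Rightarrow> ereal" where
  "diameter G = (SUP x \<in> pverts G. SUP y \<in> pverts G. graph_dist G x y)"

text \<open>The radius is an integer so that the sphere of radius \<open>r - 1\<close> is empty for \<open>r = 0\<close>.\<close>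

definition dist_sphere :: "'a pair_pre_digraph \<Rightarrow> int \<Rightarrow> 'a \<Rightarrow> 'a set" where
  "dist_sphere G r x = {y \<in> pverts G. graph_dist G x y = ereal (real_of_int r)}"

definition regular_graph :: "'a pair_pre_digraph \<Rightarrow> bool" where
  "regular_graph G \<longleftrightarrow> (\<exists>m. \<forall>x \<in> pverts G. out_degree (with_proj G) x = m)"

text \<open>
  The diameter of a distance regular graph is a natural number, so such a graph is nonempty and
  connected.
\<close>

definition distance_regular :: "'a pair_pre_digraph \<Rightarrow> bool" where
  "distance_regular G \<longleftrightarrow>
     pair_graph G \<and> regular_graph G \<and>
     (\<exists>d::nat. diameter G = ereal (real d) \<and>
       (\<forall>r::int. 0 \<le> r \<and> r \<le> int d \<longrightarrow>
         (\<exists>c b :: nat. \<forall>x \<in> pverts G. \<forall>y \<in> pverts G.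
            graph_dist G x y = ereal (real_of_int r) \<longrightarrow>
              card (dist_sphere G (r - 1) y \<inter> dist_sphere G 1 x) = c \<and>
              card (dist_sphere G (r + 1) y \<inter> dist_sphere G 1 x) = b)))"

text \<open>\<open>E(2.O\<^sub>k)\<close> is the extended bipartite double of the odd graph \<open>O\<^sub>k\<close>.\<close>

definition E2O_verts :: "nat \<Rightarrow> (nat set \<times> nat) set" where
  "E2O_verts k = {(v, i). v \<subseteq> {1..2 * k - 1} \<and> card v = k - 1 \<and> i \<in> {0, 1}}"

definition E2O :: "nat \<Rightarrow> (nat set \<times> nat) pair_pre_digraph" where
  "E2O k =
    \<lparr> pverts = E2O_verts k,
      parcs = {((v, i), (w, j)) | v i w j.
        (v, i) \<in> E2O_verts k \<and> (w, j) \<in> E2O_verts k \<and> i \<noteq> j \<and> (v \<inter> w = {} \<or> v = w)} \<rparr>"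

lemma pair_graph_E2O: "pair_graph (E2O k)"
proof -
  have "E2O_verts k \<subseteq> Pow {1..2 * k - 1} \<times> {0, 1}"
    by (auto simp: E2O_verts_def)
  then have fin: "finite (E2O_verts k)"
    by (rule finite_subset) simp
  have "parcs (E2O k) \<subseteq> E2O_verts k \<times> E2O_verts k"
    by (auto simp: E2O_def)
  then have "finite (parcs (E2O k))"
    by (rule finite_subset) (simp add: fin)
  then show ?thesis
    using fin
    by unfold_locales (auto simp: E2O_def symmetric_def sym_def)
qed

end

theory Submission
  imports Defs
begin

text \<open>
  The numbers \<open>c\<^sub>2\<close> are not constant: in a distance regular graph, two vertices at distance two have
  the same number of common neighbours, whichever pair is chosen
  (\<open>distance_regular_common_neighbours\<close>).

  In \<open>E2O k\<close>, neighbours of \<open>(v, 0)\<close> are the \<open>(u, 1)\<close> with \<open>u = v\<close> or \<open>u\<close> disjoint from \<open>v\<close>.  Let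
  \<open>v\<close> and \<open>w\<close> be distinct \<open>(k - 1)\<close>-sets, and look at the common neighbours of \<open>(v, 0)\<close> and
  \<open>(w, 0)\<close>.  If \<open>v\<close> and \<open>w\<close> are disjoint, they are \<open>(v, 1)\<close> and \<open>(w, 1)\<close>: a third one would be a
  \<open>(k - 1)\<close>-set in the single point outside \<open>v \<union> w\<close>, and \<open>k - 1 \<ge> 2\<close>.  If \<open>v\<close> and \<open>w\<close> share all but
  one point, they meet because \<open>k - 2 \<ge> 1\<close>, so neither \<open>(v, 1)\<close> nor \<open>(w, 1)\<close> counts, and the only
  common neighbour comes from the complement of \<open>v \<union> w\<close>, which has exactly \<open>k - 1\<close> points.  Both
  pairs are at distance two, with two common neighbours and one, respectively.
\<close>

section \<open>Distances one and two\<close>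

context pair_wf_digraph
begin

lemma graph_dist_le_length:
  assumes "awalk u p v"
  shows "graph_dist G u v \<le> ereal (real (length p))"
  using min_cost_le_walk_cost[OF assms, of "\<lambda>_. 1"]
  by (simp add: graph_dist_def awalk_cost_def sum_list_triv)

lemma graph_dist_geI:
  assumes "\<And>p. awalk u p v \<Longrightarrow> n \<le> length p"
  shows "ereal (real n) \<le> graph_dist G u v"
  unfolding graph_dist_def \<mu>_def
  by (rule INF_greatest) (use assms in \<open>auto simp: awalk_cost_def sum_list_triv\<close>)

lemma two_le_graph_dist:
  assumes "u \<noteq> v" "(u, v) \<notin> parcs G"
  shows "2 \<le> graph_dist G u v"
proof -
  have "2 \<le> length p" if "awalk u p v" for p
  proof (rule ccontr)
    assume "\<not> 2 \<le> length p"
    then consider "p = []" | e where "p = [e]"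
      by (cases p; cases "tl p") auto
    then show False
      using that assms by cases (auto simp: awalk_Nil_iff awalk_Cons_iff)
  qed
  from graph_dist_geI[OF this] show ?thesis
    by simp
qed

lemma graph_dist_eq_two:
  assumes "u \<noteq> v" "(u, v) \<notin> parcs G" "(u, w) \<in> parcs G" "(w, v) \<in> parcs G"
  shows "graph_dist G u v = 2"
proof (rule antisym)
  have "awalk u [(u, w), (w, v)] v"
    using assms by (auto simp: awalk_Nil_iff awalk_Cons_iff dest: in_arcsD2)
  from graph_dist_le_length[OF this] show "graph_dist G u v \<le> 2"
    by simp
qed (rule two_le_graph_dist[OF assms(1,2)])

end

lemma (in pair_loopfree_digraph) graph_dist_eq_one_iff:
  assumes "u \<in> pverts G"
  shows "graph_dist G u v = 1 \<longleftrightarrow> (u, v) \<in> parcs G"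
proof
  assume dist: "graph_dist G u v = 1"
  have "u \<noteq> v"
  proof
    assume "u = v"
    then have "awalk u [] v"
      using assms by (simp add: awalk_Nil_iff)
    from graph_dist_le_length[OF this] show False
      using dist by simp
  qed
  moreover have "\<not> 2 \<le> graph_dist G u v"
    using dist by simp
  ultimately show "(u, v) \<in> parcs G"
    using two_le_graph_dist by blast
next
  assume arc: "(u, v) \<in> parcs G"
  then have "u \<noteq> v"
    using no_loops' by blast
  have "awalk u [(u, v)] v"
    using arc by (auto simp: awalk_Nil_iff awalk_Cons_iff dest: in_arcsD2)
  from graph_dist_le_length[OF this] have "graph_dist G u v \<le> 1"
    by (simp add: one_ereal_def)
  moreover have "1 \<le> length p" if "awalk u p v" for p
    using that \<open>u \<noteq> v\<close> by (cases p) (auto simp: awalk_Nil_iff)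
  from graph_dist_geI[OF this] have "1 \<le> graph_dist G u v"
    by (simp add: one_ereal_def)
  ultimately show "graph_dist G u v = 1"
    by (rule antisym)
qed

lemma (in pair_loopfree_digraph) dist_sphere_one:
  assumes "u \<in> pverts G"
  shows "dist_sphere G 1 u = {v. (u, v) \<in> parcs G}"
  using graph_dist_eq_one_iff[OF assms] by (auto simp: dist_sphere_def one_ereal_def dest: in_arcsD2)

text \<open>
  The common neighbours of two vertices at distance two are counted by the parameter \<open>c\<^sub>2\<close>, which
  makes sense because a pair at distance two forces the diameter to be at least two.
\<close>

lemma distance_regular_common_neighbours:
  assumes "distance_regular G"
  obtains c where "\<And>x y. \<lbrakk>x \<in> pverts G; y \<in> pverts G; graph_dist G x y = 2\<rbrakk>
    \<Longrightarrow> card {z. (y, z) \<in> parcs G \<and> (x, z) \<in> parcs G} = c"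
proof (cases "\<exists>x \<in> pverts G. \<exists>y \<in> pverts G. graph_dist G x y = 2")
  case True
  from assms interpret pair_graph G
    by (simp add: distance_regular_def)
  from assms obtain d :: nat where d: "diameter G = ereal (real d)"
    and par: "\<And>r::int. 0 \<le> r \<Longrightarrow> r \<le> int d \<Longrightarrow> \<exists>c b :: nat. \<forall>x \<in> pverts G. \<forall>y \<in> pverts G.
      graph_dist G x y = ereal (real_of_int r) \<longrightarrow>
        card (dist_sphere G (r - 1) y \<inter> dist_sphere G 1 x) = c \<and>
        card (dist_sphere G (r + 1) y \<inter> dist_sphere G 1 x) = b"
    unfolding distance_regular_def by blast
  from True obtain x y where "x \<in> pverts G" "y \<in> pverts G" "graph_dist G x y = 2"
    by blast
  then have "2 \<le> diameter G"
    unfolding diameter_def by (metis SUP_upper2 order_refl)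
  then have "2 \<le> int d"
    by (simp add: d)
  from par[OF _ this] obtain c where c: "\<And>x y. x \<in> pverts G \<Longrightarrow> y \<in> pverts G \<Longrightarrow>
      graph_dist G x y = 2 \<Longrightarrow> card (dist_sphere G 1 y \<inter> dist_sphere G 1 x) = c"
    by auto
  show thesis
  proof (rule that)
    fix x y
    assume "x \<in> pverts G" "y \<in> pverts G" "graph_dist G x y = 2"
    then show "card {z. (y, z) \<in> parcs G \<and> (x, z) \<in> parcs G} = c"
      using c[of x y] by (simp add: dist_sphere_one Collect_conj_eq)
  qed
next
  \<comment> \<open>Without such a pair, for instance in a complete graph, any number will do.\<close>
  case False
  then show thesis
    using that by blast
qed

section \<open>Common neighbours in the extended double of the odd graph\<close>

lemma pverts_E2O [simp]: "pverts (E2O k) = E2O_verts k"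
  by (simp add: E2O_def)

lemma parcs_E2O_iff [simp]:
  "((v, i), (w, j)) \<in> parcs (E2O k) \<longleftrightarrow>
    (v, i) \<in> E2O_verts k \<and> (w, j) \<in> E2O_verts k \<and> i \<noteq> j \<and> (v \<inter> w = {} \<or> v = w)"
  by (simp add: E2O_def)

lemma E2O_vertsD:
  assumes "(v, i) \<in> E2O_verts k"
  shows "v \<subseteq> {1..2 * k - 1}" "card v = k - 1" "finite v" "i = 0 \<or> i = 1"
  using assms by (auto simp: E2O_verts_def intro: finite_subset)

lemma common_neighbours_E2O:
  assumes "(v, 0) \<in> E2O_verts k" "(w, 0) \<in> E2O_verts k"
  shows "{z. ((w, 0), z) \<in> parcs (E2O k) \<and> ((v, 0), z) \<in> parcs (E2O k)}
    = {u. (u, 1) \<in> E2O_verts k \<and> (v \<inter> u = {} \<or> v = u) \<and> (w \<inter> u = {} \<or> w = u)} \<times> {1}"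
    (is "?L = ?R")
proof (rule set_eqI)
  fix z
  obtain u :: "nat set" and i :: nat where z: "z = (u, i)"
    by fastforce
  consider "i = 0" | "i = 1" | "(u, i) \<notin> E2O_verts k" "i \<noteq> 1"
    using E2O_vertsD(4) by blast
  then show "z \<in> ?L \<longleftrightarrow> z \<in> ?R"
    by cases (use assms in \<open>auto simp: z\<close>)
qed

text \<open>
  A common neighbour other than the obvious two would give three pairwise disjoint \<open>(k - 1)\<close>-sets,
  and \<open>3 * (k - 1) > 2 * k - 1\<close> as soon as \<open>k > 2\<close>.
\<close>

lemma common_neighbours_disjoint:
  assumes "k \<ge> 3" "(v, 0) \<in> E2O_verts k" "(w, 0) \<in> E2O_verts k" "v \<inter> w = {}"
  shows "{z. ((w, 0), z) \<in> parcs (E2O k) \<and> ((v, 0), z) \<in> parcs (E2O k)} = {v, w} \<times> {1}"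
proof -
  note v = E2O_vertsD[OF assms(2)] and w = E2O_vertsD[OF assms(3)]
  have "u = v \<or> u = w" if u: "(u, 1) \<in> E2O_verts k"
    and vu: "v \<inter> u = {} \<or> v = u" and wu: "w \<inter> u = {} \<or> w = u" for u
  proof (rule ccontr)
    assume "\<not> (u = v \<or> u = w)"
    with vu wu have disj: "(v \<union> w) \<inter> u = {}"
      by auto
    note u = E2O_vertsD[OF u]
    have "card (v \<union> w \<union> u) = 3 * (k - 1)"
      using v w u assms(4) disj by (simp add: card_Un_disjoint)
    moreover have "card (v \<union> w \<union> u) \<le> card {1..2 * k - 1}"
      using v w u by (intro card_mono) auto
    ultimately show False
      using assms(1) by simp
  qed
  moreover have "(v, 1) \<in> E2O_verts k" "(w, 1) \<in> E2O_verts k"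
    using assms(2,3) by (simp_all add: E2O_verts_def)
  moreover have "w \<inter> v = {}"
    using assms(4) by blast
  ultimately have "{u. (u, 1) \<in> E2O_verts k \<and> (v \<inter> u = {} \<or> v = u) \<and> (w \<inter> u = {} \<or> w = u)}
      = {v, w}"
    using assms(4) by blast
  then show ?thesis
    by (simp only: common_neighbours_E2O[OF assms(2,3)])
qed

text \<open>
  As \<open>v\<close> and \<open>w\<close> meet, a common neighbour has to be disjoint from both; \<open>v \<union> w\<close> has \<open>k\<close> points,
  so its complement is already a \<open>(k - 1)\<close>-set.
\<close>

lemma common_neighbours_overlapping:
  assumes "k \<ge> 3" "(v, 0) \<in> E2O_verts k" "(w, 0) \<in> E2O_verts k" "card (v \<inter> w) = k - 2"
  shows "{z. ((w, 0), z) \<in> parcs (E2O k) \<and> ((v, 0), z) \<in> parcs (E2O k)}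
    = {{1..2 * k - 1} - (v \<union> w)} \<times> {1}"
proof -
  note v = E2O_vertsD[OF assms(2)] and w = E2O_vertsD[OF assms(3)]
  define u0 where "u0 = {1..2 * k - 1} - (v \<union> w)"
  have meet: "v \<inter> w \<noteq> {}"
    using assms(1,4) by auto
  have "v \<noteq> w"
    using v(2) assms(1,4) by auto
  have "card (v \<union> w) = k"
    using card_Un_Int[OF v(3) w(3)] v(2) w(2) assms(1,4) by simp
  moreover have "v \<union> w \<subseteq> {1..2 * k - 1}"
    using v w by blast
  ultimately have card: "card u0 = k - 1"
    using v w by (simp add: u0_def card_Diff_subset)
  have unique: "u = u0" if u: "(u, 1) \<in> E2O_verts k"
    and "v \<inter> u = {} \<or> v = u" and "w \<inter> u = {} \<or> w = u" for u
  proof (rule card_subset_eq)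
    show "u \<subseteq> u0"
      using that E2O_vertsD(1)[OF u] meet \<open>v \<noteq> w\<close> unfolding u0_def by blast
    show "card u = card u0"
      using E2O_vertsD(2)[OF u] card by simp
  qed (simp add: u0_def)
  have "(u0, 1) \<in> E2O_verts k"
    using card by (auto simp: E2O_verts_def u0_def)
  moreover have "v \<inter> u0 = {}" "w \<inter> u0 = {}"
    by (auto simp: u0_def)
  ultimately have "{u. (u, 1) \<in> E2O_verts k \<and> (v \<inter> u = {} \<or> v = u) \<and> (w \<inter> u = {} \<or> w = u)}
      = {u0}"
    using unique by blast
  then show ?thesis
    by (simp only: common_neighbours_E2O[OF assms(2,3)] u0_def)
qed

text \<open>
  Two vertices in the same half of this bipartite graph are never adjacent, so one common neighbour
  is enough to put them at distance two.
\<close>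

lemma graph_dist_E2O_eq_two:
  assumes "v \<noteq> w" and "z \<in> {z. ((w, i), z) \<in> parcs (E2O k) \<and> ((v, i), z) \<in> parcs (E2O k)}"
  shows "graph_dist (E2O k) (v, i) (w, i) = 2"
proof -
  interpret pair_graph "E2O k"
    by (rule pair_graph_E2O)
  show ?thesis
    using assms by (intro graph_dist_eq_two[of _ _ z]) (auto intro: arcs_symmetric)
qed

theorem proposition3p3:
  fixes k :: nat
  assumes "k \<ge> 3"
  shows "\<not> distance_regular (E2O k)"
proof
  assume "distance_regular (E2O k)"
  then obtain c where c: "\<And>x y. \<lbrakk>x \<in> pverts (E2O k); y \<in> pverts (E2O k);
      graph_dist (E2O k) x y = 2\<rbrakk>
      \<Longrightarrow> card {z. (y, z) \<in> parcs (E2O k) \<and> (x, z) \<in> parcs (E2O k)} = c"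
    by (rule distance_regular_common_neighbours) blast
  \<comment> \<open>\<open>?disj\<close> and \<open>?shift\<close> are translates of \<open>?v\<close>, by \<open>k - 1\<close> and by one.\<close>
  let ?v = "{1..k - 1}" and ?disj = "{k..2 * k - 2}" and ?shift = "{2..k}"
  have verts: "(?v, 0) \<in> E2O_verts k" "(?disj, 0) \<in> E2O_verts k" "(?shift, 0) \<in> E2O_verts k"
    using assms by (auto simp: E2O_verts_def)
  have "?v \<inter> ?disj = {}"
    using assms by auto
  note two = common_neighbours_disjoint[OF assms verts(1,2) this]
  have "?v \<inter> ?shift = {2..k - 1}"
    by auto
  then have "card (?v \<inter> ?shift) = k - 2"
    by simp
  note one = common_neighbours_overlapping[OF assms verts(1,3) this]
  have "1 \<in> ?v" "1 \<notin> ?disj" "1 \<notin> ?shift"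
    using assms by auto
  then have ne: "?v \<noteq> ?disj" "?v \<noteq> ?shift"
    by metis+
  have "graph_dist (E2O k) (?v, 0) (?disj, 0) = 2"
    by (rule graph_dist_E2O_eq_two[OF ne(1), of "(?v, 1)"]) (unfold two, simp)
  with c[of "(?v, 0)" "(?disj, 0)"] verts two ne have "c = 2"
    by (simp del: parcs_E2O_iff)
  moreover have "graph_dist (E2O k) (?v, 0) (?shift, 0) = 2"
    by (rule graph_dist_E2O_eq_two[OF ne(2)]) (unfold one, blast)
  with c[of "(?v, 0)" "(?shift, 0)"] verts one have "c = 1"
    by (simp del: parcs_E2O_iff)
  ultimately show False
    by simp
qed

end
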